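(* Let $G$, $H$, $K$ be finite groups, let $R$ be a commutative ring such that $|H|$ is invertible in $R$, and let $L\le G\times H$, $M\le H\times K$ and $N\le G\times K$ be subgroups. Then $$a_N^{L,M}=\begin{cases}0&\text{if }(L,M)\notin\mathscr{Y}_N,\\[2pt] \displaystyle\sum_{(L',M')\in\mathscr{Y}_N^{L,M}}\mu^{\mathscr{Y}_N}_{(L',M'),(L,M)}\cdot\kappa(L',M')&\text{if }(L,M)\in\mathscr{Y}_N.\end{cases}$$
   Context: For a finite group $X$, $\mathscr{S}_X$ is the set of subgroups of $X$. For $L\le G\times H$, $p_1(L)\le G$ and $p_2(L)\le H$ are the images of $L$ under the two projections, $k_1(L)=\{g\in G\mid(g,1)\in L\}$ and $k_2(L)=\{h\in H\mid(1,h)\in L\}$. For $L\le G\times H$ and $M\le H\times K$ put $L*M=\{(g,k)\in G\times K\mid\exists\,h\in H:\ (g,h)\in L,\ (h,k)\in M\}$ and $\kappa(L,M)=\frac{|k_2(L)\cap k_1(M)|}{|H|}\in R$. The set $\mathscr{S}_{G\times H}\times\mathscr{S}_{H\times K}$ is partially ordered by $(L',M')\le(L,M)$ iff $L'\le L$ and $M'\le M$. The Möbius function $\mu^{\mathscr{X}}$ of a finite poset $\mathscr{X}$ is given by $\mu^{\mathscr{X}}_{x,y}=0$ if $x\not\le y$ and $\sum_{x\le z\le y}\mu^{\mathscr{X}}_{x,z}=\delta_{x,y}$ if $x\le y$. The coefficient $a_N^{L,M}\in R$ is defined by $$a_N^{L,M}:=\sum_{\substack{(L',M')\le(L,M)\\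 N\le L'*M'}}\mu^{\mathscr{S}_{G\times H}\times\mathscr{S}_{H\times K}}_{(L',M'),(L,M)}\cdot\kappa(L',M').$$ For $N\le G\times K$ let $$\mathscr{Y}_N:=\{(L,M)\in\mathscr{S}_{G\times H}\times\mathscr{S}_{H\times K}\mid N\le L*M,\ p_1(L)=p_1(N),\ p_2(L)=p_1(M),\ p_2(M)=p_2(N)\},$$ considered as a subposet of $\mathscr{S}_{G\times H}\times\mathscr{S}_{H\times K}$ with Möbius function $\mu^{\mathscr{Y}_N}$, and for $(L,M)\in\mathscr{Y}_N$ let $\mathscr{Y}_N^{L,M}:=\{(L',M')\in\mathscr{Y}_N\mid(L',M')\le(L,M)\}$. *)

theory Defs
  imports "HOL-Algebra.Ring" "HOL-Algebra.Coset" "HOL-Library.Product_Order"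
begin

text \<open>
  The ambient type supplies the order and \<open>X\<close> is the (finite) underlying set of the poset, so that
  a subposet has its own Moebius function.  The recursion solves
  \<open>(\<Sum>x \<le> z \<le> y. mobius X x z) = \<delta>\<close> for its last term; see \<open>sum_mobius\<close> and \<open>mobius_unique\<close>.
\<close>

function mobius :: "'a::order set \<Rightarrow> 'a \<Rightarrow> 'a \<Rightarrow> int" where
  "mobius X x y =
    (if finite X \<and> x \<in> X \<and> y \<in> X \<and> x \<le> y
     then if x = y then 1 else - (\<Sum>z \<in> {z \<in> X. x \<le> z \<and> z < y}. mobius X x z)
     else 0)"
  by pat_completeness auto
termination
  by (relation "measure (\<lambda>(X, x, y). card {z \<in> X. z < y})")
     (auto intro!: psubset_card_mono dest: less_trans)

declare mobius.simps [simp del]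

lemma mobius_not_le: "\<not> x \<le> y \<Longrightarrow> mobius X x y = 0"
  by (simp add: mobius.simps)

lemma sum_mobius:
  assumes "finite X" "x \<in> X" "y \<in> X" "x \<le> y"
  shows "(\<Sum>z \<in> {z \<in> X. x \<le> z \<and> z \<le> y}. mobius X x z) = (if x = y then 1 else 0)"
proof -
  have "{z \<in> X. x \<le> z \<and> z \<le> y} = insert y {z \<in> X. x \<le> z \<and> z < y}"
    using assms by auto
  then have "(\<Sum>z \<in> {z \<in> X. x \<le> z \<and> z \<le> y}. mobius X x z) =
      mobius X x y + (\<Sum>z \<in> {z \<in> X. x \<le> z \<and> z < y}. mobius X x z)"
    using assms by simp
  moreover have "{z \<in> X. y \<le> z \<and> z < y} = {}"
    by auto
  ultimately show ?thesis
    using assms mobius.simps [of X x y] by (cases "x = y") simp_all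
qed

lemma mobius_unique:
  assumes "finite X"
    and "\<And>x y. x \<in> X \<Longrightarrow> y \<in> X \<Longrightarrow> x \<le> y \<Longrightarrow>
      (\<Sum>z \<in> {z \<in> X. x \<le> z \<and> z \<le> y}. f x z) = (if x = y then 1 else 0)"
    and "x \<in> X" "y \<in> X" "x \<le> y"
  shows "f x y = mobius X x y"
  using assms(4,5)
proof (induction "card {z \<in> X. z < y}" arbitrary: y rule: less_induct)
  case less
  have "{z \<in> X. x \<le> z \<and> z \<le> y} = insert y {z \<in> X. x \<le> z \<and> z < y}"
    using less.prems by auto
  then have split: "(\<Sum>z \<in> {z \<in> X. x \<le> z \<and> z \<le> y}. g z) =
      g y + (\<Sum>z \<in> {z \<in> X. x \<le> z \<and> z < y}. g z)" for g :: "'a \<Rightarrow> int"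
    using assms(1) by simp
  have "f x z = mobius X x z" if "z \<in> X" "x \<le> z" "z < y" for z
  proof (rule less.hyps)
    show "card {w \<in> X. w < z} < card {w \<in> X. w < y}"
      using that assms(1) by (intro psubset_card_mono) (auto dest: less_trans)
  qed (use that in auto)
  then have "(\<Sum>z \<in> {z \<in> X. x \<le> z \<and> z < y}. f x z) =
      (\<Sum>z \<in> {z \<in> X. x \<le> z \<and> z < y}. mobius X x z)"
    by (intro sum.cong) auto
  with assms(2) [OF assms(3) less.prems] sum_mobius [OF assms(1,3) less.prems]
  show ?case
    by (simp add: split)
qed

definition subgroups :: "('a, 'm) monoid_scheme \<Rightarrow> 'a set set" where
  "subgroups G = {L. subgroup L G}"

text \<open>
  Subgroups of \<open>G \<times>\<times> H\<close> are relations between the carriers: \<open>p\<^sub>1(L)\<close> and \<open>p\<^sub>2(L)\<close> are \<open>fst ` L\<close> and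
  \<open>snd ` L\<close>, and \<open>L * M\<close> is the relational composition \<open>L O M\<close>.
\<close>

definition k1 :: "('a, 'm) monoid_scheme \<Rightarrow> ('b, 'n) monoid_scheme \<Rightarrow> ('a \<times> 'b) set \<Rightarrow> 'a set" where
  "k1 G H L = {g \<in> carrier G. (g, \<one>\<^bsub>H\<^esub>) \<in> L}"

definition k2 :: "('a, 'm) monoid_scheme \<Rightarrow> ('b, 'n) monoid_scheme \<Rightarrow> ('a \<times> 'b) set \<Rightarrow> 'b set" where
  "k2 G H L = {h \<in> carrier H. (\<one>\<^bsub>G\<^esub>, h) \<in> L}"

definition kappa ::
  "('a, 'm) monoid_scheme \<Rightarrow> ('b, 'n) monoid_scheme \<Rightarrow> ('c, 'o) monoid_scheme \<Rightarrow> ('r, 'p) ring_scheme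
    \<Rightarrow> ('a \<times> 'b) set \<times> ('b \<times> 'c) set \<Rightarrow> 'r" where
  "kappa G H K R = (\<lambda>(L, M).
    ([card (k2 G H L \<inter> k1 H K M)] \<cdot>\<^bsub>R\<^esub> \<one>\<^bsub>R\<^esub>) \<otimes>\<^bsub>R\<^esub> inv\<^bsub>R\<^esub> ([order H] \<cdot>\<^bsub>R\<^esub> \<one>\<^bsub>R\<^esub>))"

definition subgroup_pairs ::
  "('a, 'm) monoid_scheme \<Rightarrow> ('b, 'n) monoid_scheme \<Rightarrow> ('c, 'o) monoid_scheme
    \<Rightarrow> (('a \<times> 'b) set \<times> ('b \<times> 'c) set) set" where
  "subgroup_pairs G H K = subgroups (G \<times>\<times> H) \<times> subgroups (H \<times>\<times> K)"

definition a_coeff ::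
  "('a, 'm) monoid_scheme \<Rightarrow> ('b, 'n) monoid_scheme \<Rightarrow> ('c, 'o) monoid_scheme \<Rightarrow> ('r, 'p) ring_scheme
    \<Rightarrow> ('a \<times> 'c) set \<Rightarrow> ('a \<times> 'b) set \<Rightarrow> ('b \<times> 'c) set \<Rightarrow> 'r" where
  "a_coeff G H K R N L M =
    (\<Oplus>\<^bsub>R\<^esub> P \<in> {(L', M') \<in> subgroup_pairs G H K. (L', M') \<le> (L, M) \<and> N \<subseteq> L' O M'}.
      [mobius (subgroup_pairs G H K) P (L, M)] \<cdot>\<^bsub>R\<^esub> kappa G H K R P)"

definition Y ::
  "('a, 'm) monoid_scheme \<Rightarrow> ('b, 'n) monoid_scheme \<Rightarrow> ('c, 'o) monoid_scheme
    \<Rightarrow> ('a \<times> 'c) set \<Rightarrow> (('a \<times> 'b) set \<times> ('b \<times> 'c) set) set" where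
  "Y G H K N = {(L, M) \<in> subgroup_pairs G H K.
    N \<subseteq> L O M \<and> fst ` L = fst ` N \<and> snd ` L = fst ` M \<and> snd ` M = snd ` N}"

definition Y_below ::
  "('a, 'm) monoid_scheme \<Rightarrow> ('b, 'n) monoid_scheme \<Rightarrow> ('c, 'o) monoid_scheme
    \<Rightarrow> ('a \<times> 'c) set \<Rightarrow> ('a \<times> 'b) set \<Rightarrow> ('b \<times> 'c) set \<Rightarrow> (('a \<times> 'b) set \<times> ('b \<times> 'c) set) set" where
  "Y_below G H K N L M = {P \<in> Y G H K N. P \<le> (L, M)}"

end

theory Submission
  imports Defs
begin

text \<open>
  Write \<open>X\<close> for the poset of all pairs \<open>(L, M)\<close> and \<open>U\<close> for the pairs with \<open>N \<subseteq> L O M\<close>, an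
  upward closed subset of \<open>X\<close>.  Below every pair in \<open>U\<close> there is a greatest element of \<open>Y\<close>: in the
  middle group only the elements \<open>h\<close> matter that \<open>L\<close> reaches from \<open>p\<^sub>1(N)\<close> and from which \<open>M\<close> reaches
  \<open>p\<^sub>2(N)\<close>, so the three groups are cut down to \<open>p\<^sub>1(N)\<close>, to these \<open>h\<close>, and to \<open>p\<^sub>2(N)\<close>.  Thus
  \<open>trim N\<close> is an interior operator on \<open>U\<close> with image \<open>Y\<close> (\<open>trim_in_Y\<close>, \<open>le_trim_iff\<close>).  It does not
  change \<open>\<kappa>\<close>, because every \<open>h \<in> k\<^sub>2(L) \<inter> k\<^sub>1(M)\<close> is related to the units of \<open>G\<close> and \<open>K\<close>, which lie
  in the projections of \<open>N\<close> (\<open>kappa_trim\<close>).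

  Hence the terms of \<open>a_coeff\<close> can be collected according to the trimmed pair \<open>w\<close>, and the
  coefficient of \<open>\<kappa>(w)\<close> becomes a sum of values \<open>\<mu>(x, (L, M))\<close> over the fibre of the operator above
  \<open>w\<close>.  For any interior operator on an upward closed subset of a finite poset, such a fibre sum is
  the Moebius function of the image if \<open>(L, M)\<close> belongs to the image and vanishes otherwise
  (\<open>sum_mobius_fibre\<close>).  This dichotomy is the one in the theorem.
\<close>

section \<open>Moebius functions and interior operators\<close>

text \<open>
  The recursion says \<open>\<mu>\<zeta> = 1\<close> in the incidence algebra.  Then \<open>\<mu>(\<zeta>\<mu>) = \<mu>\<close>, and since \<open>\<mu>\<close> is
  unitriangular it can be cancelled, which gives \<open>\<zeta>\<mu> = 1\<close>.
\<close>

lemma sum_mobius_left: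
  assumes "finite X" "x \<in> X" "y \<in> X" "x \<le> y"
  shows "(\<Sum>z \<in> {z \<in> X. x \<le> z \<and> z \<le> y}. mobius X z y) = (if x = y then 1 else 0)"
  using assms(2,4)
proof (induction "card {z \<in> X. x < z}" arbitrary: x rule: less_induct)
  case less
  \<comment> \<open>\<open>S u\<close> is the entry of \<open>\<zeta>\<mu>\<close> at \<open>(u, y)\<close>; cancelling \<open>\<mu>\<close> is a downward induction on the row.\<close>
  define S where "S u = (\<Sum>z \<in> {z \<in> X. u \<le> z \<and> z \<le> y}. mobius X z y)" for u
  have S: "S u = (if u = y then 1 else 0)" if "u \<in> X" "x < u" "u \<le> y" for u
    unfolding S_def
  proof (rule less.hyps)
    show "card {z \<in> X. u < z} < card {z \<in> X. x < z}"
      using that assms(1) by (intro psubset_card_mono) (auto dest: less_trans)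
  qed (use that in auto)
  have fin: "finite {u \<in> X. P u}" for P
    using assms(1) by simp
  have split: "{u \<in> X. x \<le> u \<and> u \<le> y} = insert x {u \<in> X. x < u \<and> u \<le> y}"
    using less.prems by auto
  have "(\<Sum>u \<in> {u \<in> X. x \<le> u \<and> u \<le> y}. mobius X x u * S u) =
      (\<Sum>u \<in> {u \<in> X. x \<le> u \<and> u \<le> y}. \<Sum>z \<in> {z \<in> {z \<in> X. x \<le> z \<and> z \<le> y}. u \<le> z}.
        mobius X x u * mobius X z y)"
    unfolding S_def sum_distrib_left by (intro sum.cong) auto
  also have "\<dots> = (\<Sum>z \<in> {z \<in> X. x \<le> z \<and> z \<le> y}. \<Sum>u \<in> {u \<in> {u \<in> X. x \<le> u \<and> u \<le> y}. u \<le> z}.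
        mobius X x u * mobius X z y)"
    using assms(1) by (intro sum.swap_restrict) auto
  also have "\<dots> = (\<Sum>z \<in> {z \<in> X. x \<le> z \<and> z \<le> y}.
        (\<Sum>u \<in> {u \<in> X. x \<le> u \<and> u \<le> z}. mobius X x u) * mobius X z y)"
    unfolding sum_distrib_right by (intro sum.cong) auto
  also have "\<dots> = (\<Sum>z \<in> {z \<in> X. x \<le> z \<and> z \<le> y}. if z = x then mobius X x y else 0)"
    using assms(1) less.prems by (intro sum.cong) (auto simp: sum_mobius)
  also have "\<dots> = mobius X x y"
    using less.prems fin by simp
  finally have "mobius X x x * S x + (\<Sum>u \<in> {u \<in> X. x < u \<and> u \<le> y}. mobius X x u * S u) =
      mobius X x y"
    unfolding split using fin by simp
  moreover have "(\<Sum>u \<in> {u \<in> X. x < u \<and> u \<le> y}. mobius X x u * S u) =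
      (\<Sum>u \<in> {u \<in> X. x < u \<and> u \<le> y}. if u = y then mobius X x y else 0)"
    using S by (intro sum.cong) auto
  moreover have "\<dots> = (if x < y then mobius X x y else 0)"
    using fin assms(3) by simp
  moreover have "mobius X x x = 1"
    using assms(1) less.prems by (simp add: mobius.simps)
  ultimately show ?case
    using less.prems unfolding S_def [symmetric] by (auto split: if_splits)
qed

text \<open>
  Summing over up-sets is a unitriangular operation, hence injective.
\<close>

lemma eq_if_upset_sums_eq:
  fixes f g :: "'a::order \<Rightarrow> int"
  assumes "finite Q"
    and sums: "\<And>v. v \<in> Q \<Longrightarrow> (\<Sum>w \<in> {w \<in> Q. v \<le> w}. f w) = (\<Sum>w \<in> {w \<in> Q. v \<le> w}. g w)"
    and "w \<in> Q"
  shows "f w = g w"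
  using assms(3)
proof (induction "card {z \<in> Q. w < z}" arbitrary: w rule: less_induct)
  case less
  have split: "{z \<in> Q. w \<le> z} = insert w {z \<in> Q. w < z}"
    using less.prems by auto
  have "f z = g z" if "z \<in> Q" "w < z" for z
  proof (rule less.hyps)
    show "card {u \<in> Q. z < u} < card {u \<in> Q. w < u}"
      using that assms(1) by (intro psubset_card_mono) (auto dest: less_trans)
  qed (use that in auto)
  then have "(\<Sum>z \<in> {z \<in> Q. w < z}. f z) = (\<Sum>z \<in> {z \<in> Q. w < z}. g z)"
    by (intro sum.cong) auto
  with sums [OF less.prems] show ?case
    using assms(1) by (simp add: split)
qed

text \<open>
  The assumption relating \<open>r\<close> to the order makes \<open>r x\<close> the greatest element of \<open>Q\<close> below \<open>x\<close>.  As
  functions of \<open>w\<close>, both sides have the same sums over the up-sets \<open>{w \<in> Q. v \<le> w}\<close>: on the left,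
  \<open>v \<le> r x\<close> means \<open>v \<le> x\<close>, so the fibres assemble to the interval from \<open>v\<close> to \<open>y\<close> in \<open>X\<close>, and its
  sum is \<open>1\<close> if \<open>v = y\<close> and \<open>0\<close> otherwise.  The right side has this sum by the same identity in \<open>Q\<close>.
\<close>

lemma sum_mobius_fibre:
  fixes X :: "'a::order set"
  assumes "finite X" "U \<subseteq> X" "Q \<subseteq> U"
    and up: "\<And>u x. u \<in> U \<Longrightarrow> x \<in> X \<Longrightarrow> u \<le> x \<Longrightarrow> x \<in> U"
    and r: "\<And>x. x \<in> U \<Longrightarrow> r x \<in> Q"
    and adj: "\<And>v x. v \<in> Q \<Longrightarrow> x \<in> U \<Longrightarrow> v \<le> r x \<longleftrightarrow> v \<le> x"
    and "y \<in> X" "w \<in> Q"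
  shows "(\<Sum>x \<in> {x \<in> U. x \<le> y \<and> r x = w}. mobius X x y) =
    (if y \<in> Q then mobius Q w y else 0)"
proof (rule eq_if_upset_sums_eq [OF _ _ \<open>w \<in> Q\<close>])
  show finQ: "finite Q"
    using assms by (meson finite_subset)
  have finU: "finite U"
    using assms by (meson finite_subset)
  fix v assume v: "v \<in> Q"
  then have "v \<in> U" "v \<in> X"
    using assms by auto
  have "(\<Sum>w \<in> {w \<in> Q. v \<le> w}. \<Sum>x \<in> {x \<in> U. x \<le> y \<and> r x = w}. mobius X x y) =
      (\<Sum>w \<in> {w \<in> Q. v \<le> w}. \<Sum>x \<in> {x \<in> {x \<in> U. v \<le> x \<and> x \<le> y}. r x = w}. mobius X x y)"
    using adj [OF v] by (intro sum.cong) auto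
  also have "\<dots> = (\<Sum>x \<in> {x \<in> U. v \<le> x \<and> x \<le> y}. mobius X x y)"
    using finQ finU r adj [OF v] by (intro sum.group) auto
  also have "{x \<in> U. v \<le> x \<and> x \<le> y} = {x \<in> X. v \<le> x \<and> x \<le> y}"
    using up [OF \<open>v \<in> U\<close>] assms(2) by auto
  also have "(\<Sum>x \<in> \<dots>. mobius X x y) = (if v = y then 1 else 0)"
  proof (cases "v \<le> y")
    case False
    then have "{x \<in> X. v \<le> x \<and> x \<le> y} = {}"
      by (auto dest: order_trans)
    with False show ?thesis
      by (auto simp del: Collect_empty_eq)
  qed (use sum_mobius_left [OF assms(1) \<open>v \<in> X\<close> assms(7)] in auto)
  also have "\<dots> = (\<Sum>w \<in> {w \<in> Q. v \<le> w}. if y \<in> Q then mobius Q w y else 0)"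
  proof (cases "y \<in> Q \<and> v \<le> y")
    case True
    have "(\<Sum>w \<in> {w \<in> Q. v \<le> w}. mobius Q w y) =
        (\<Sum>w \<in> {w \<in> Q. v \<le> w \<and> w \<le> y}. mobius Q w y)"
      using finQ by (intro sum.mono_neutral_right) (auto simp: mobius_not_le)
    with True show ?thesis
      using sum_mobius_left [OF finQ v] by auto
  next
    case False
    then have "(\<Sum>w \<in> {w \<in> Q. v \<le> w}. if y \<in> Q then mobius Q w y else 0) = 0"
      by (intro sum.neutral) (auto intro!: mobius_not_le dest: order_trans)
    with False v show ?thesis
      by auto
  qed
  finally show "(\<Sum>w \<in> {w \<in> Q. v \<le> w}. \<Sum>x \<in> {x \<in> U. x \<le> y \<and> r x = w}. mobius X x y) =
      (\<Sum>w \<in> {w \<in> Q. v \<le> w}. if y \<in> Q then mobius Q w y else 0)" .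
qed

section \<open>Regrouping a sum of integer multiples\<close>

lemma (in abelian_group) finsum_add_pow_const:
  fixes f :: "'i \<Rightarrow> int"
  assumes "finite A" "c \<in> carrier G"
  shows "(\<Oplus>x\<in>A. [(f x)] \<cdot> c) = [(\<Sum>x\<in>A. f x)] \<cdot> c"
  using assms
proof (induction A)
  case empty
  then show ?case
    by (simp add: add_pow_def)
qed (auto simp: add.int_pow_mult)

text \<open>
  The ring-valued factor depends on \<open>x\<close> only through \<open>r x\<close>, so all the integers over one fibre of \<open>r\<close>
  can be added before the multiple is taken.
\<close>

lemma (in abelian_group) finsum_group_fibres:
  fixes f :: "'i \<Rightarrow> int" and r :: "'i \<Rightarrow> 'j"
  assumes "finite A" "finite B" "r ` A \<subseteq> B" "\<And>w. w \<in> B \<Longrightarrow> c w \<in> carrier G"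
  shows "(\<Oplus>x\<in>A. [(f x)] \<cdot> c (r x)) = (\<Oplus>w\<in>B. [(\<Sum>x\<in>{x \<in> A. r x = w}. f x)] \<cdot> c w)"
proof -
  have "A = (\<Union>w\<in>B. {x \<in> A. r x = w})"
    using assms(3) by auto
  then have "(\<Oplus>x\<in>A. [(f x)] \<cdot> c (r x)) = (\<Oplus>x\<in>(\<Union>w\<in>B. {x \<in> A. r x = w}). [(f x)] \<cdot> c (r x))"
    by simp
  also have "\<dots> = (\<Oplus>w\<in>B. \<Oplus>x\<in>{x \<in> A. r x = w}. [(f x)] \<cdot> c (r x))"
    using assms by (intro add.finprod_UN_disjoint) (auto simp: pairwise_def disjnt_def)
  also have "\<dots> = (\<Oplus>w\<in>B. \<Oplus>x\<in>{x \<in> A. r x = w}. [(f x)] \<cdot> c w)"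
    using assms by (intro finsum_cong' refl) auto
  also have "\<dots> = (\<Oplus>w\<in>B. [(\<Sum>x\<in>{x \<in> A. r x = w}. f x)] \<cdot> c w)"
    using assms by (intro finsum_cong') (auto simp: finsum_add_pow_const)
  finally show ?thesis .
qed

section \<open>Subgroups of direct products as relations\<close>

text \<open>
  Images of this kind, under a subgroup or its converse, yield both projections of a subgroup and
  the middle group of a trimmed pair.
\<close>

lemma subgroup_Image:
  assumes G: "group G" and H: "group H" and L: "subgroup L (G \<times>\<times> H)" and P: "subgroup P G"
  shows "subgroup (L `` P) H"
proof -
  interpret G: group G by fact
  interpret H: group H by fact
  interpret L: subgroup L "G \<times>\<times> H" by fact
  interpret P: subgroup P G by fact
  show ?thesis
  proof (rule H.subgroupI)
    show "L `` P \<subseteq> carrier H"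
      using L.subset by auto
    have "\<one>\<^bsub>H\<^esub> \<in> L `` P"
      using L.one_closed P.one_closed by auto
    then show "L `` P \<noteq> {}"
      by blast
  next
    fix a assume "a \<in> L `` P"
    then obtain x where x: "x \<in> P" "(x, a) \<in> L" by auto
    then have "x \<in> carrier G" "a \<in> carrier H" using L.subset by auto
    then have "(inv\<^bsub>G\<^esub> x, inv\<^bsub>H\<^esub> a) \<in> L"
      using L.m_inv_closed [OF x(2)] by (simp add: G H inv_DirProd)
    then show "inv\<^bsub>H\<^esub> a \<in> L `` P"
      using x by auto
  next
    fix a b assume "a \<in> L `` P" "b \<in> L `` P"
    then obtain x y where x: "x \<in> P" "(x, a) \<in> L" "y \<in> P" "(y, b) \<in> L" by auto
    then have "(x \<otimes>\<^bsub>G\<^esub> y, a \<otimes>\<^bsub>H\<^esub> b) \<in> L"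
      using L.m_closed [OF x(2,4)] by simp
    then show "a \<otimes>\<^bsub>H\<^esub> b \<in> L `` P"
      using x by auto
  qed
qed

lemma subgroup_converse:
  assumes G: "group G" and H: "group H" and L: "subgroup L (G \<times>\<times> H)"
  shows "subgroup (L\<inverse>) (H \<times>\<times> G)"
proof -
  interpret L: subgroup L "G \<times>\<times> H" by fact
  interpret HG: group "H \<times>\<times> G" using G H by (rule DirProd_group[rotated])
  show ?thesis
  proof (rule HG.subgroupI)
    show "L\<inverse> \<subseteq> carrier (H \<times>\<times> G)"
      using L.subset by auto
    show "L\<inverse> \<noteq> {}"
      using L.one_closed by auto
  next
    fix a assume "a \<in> L\<inverse>"
    then obtain x y where a: "a = (y, x)" and x: "(x, y) \<in> L" by auto
    then have "x \<in> carrier G" "y \<in> carrier H" using L.subset by auto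
    then show "inv\<^bsub>H \<times>\<times> G\<^esub> a \<in> L\<inverse>"
      using L.m_inv_closed [OF x] by (simp add: a G H inv_DirProd)
  next
    fix a b assume "a \<in> L\<inverse>" "b \<in> L\<inverse>"
    then show "a \<otimes>\<^bsub>H \<times>\<times> G\<^esub> b \<in> L\<inverse>"
      using L.m_closed by fastforce
  qed
qed

lemma subgroup_projections:
  assumes G: "group G" and H: "group H" and L: "subgroup L (G \<times>\<times> H)"
  shows "subgroup (fst ` L) G" "subgroup (snd ` L) H"
proof -
  have sub: "L \<subseteq> carrier G \<times> carrier H"
    using subgroup.subset [OF L] by simp
  then have "fst ` L = L\<inverse> `` carrier H" "snd ` L = L `` carrier G"
    by force+
  then show "subgroup (fst ` L) G" "subgroup (snd ` L) H"
    using assms by (simp_all add: subgroup_Image subgroup_converse group.subgroup_self)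
qed

section \<open>Trimming a pair of subgroups\<close>

text \<open>
  The elements of the middle group that occur on some path from \<open>p\<^sub>1(N)\<close> through \<open>L\<close> and \<open>M\<close> to
  \<open>p\<^sub>2(N)\<close>.  The endpoints of the path need not be related by \<open>N\<close>: membership in \<open>Y\<close> constrains
  the projections only, so asking for related endpoints could cut into pairs that lie in \<open>Y\<close>.
\<close>

definition middle :: "('a \<times> 'c) set \<Rightarrow> ('a \<times> 'b) set \<times> ('b \<times> 'c) set \<Rightarrow> 'b set" where
  "middle N P = fst P `` (fst ` N) \<inter> (snd P)\<inverse> `` (snd ` N)"

definition trim ::
  "('a \<times> 'c) set \<Rightarrow> ('a \<times> 'b) set \<times> ('b \<times> 'c) set \<Rightarrow> ('a \<times> 'b) set \<times> ('b \<times> 'c) set" where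
  "trim N P = (fst P \<inter> fst ` N \<times> middle N P, snd P \<inter> middle N P \<times> snd ` N)"

text \<open>
  If \<open>(g, k) \<in> N\<close> passes through \<open>h\<close>, then \<open>h\<close> lies in the middle set, so trimming keeps \<open>N\<close> inside the
  composition.  This gives the outer projections as well.  The inner ones agree after a single
  trimming step, because each element of the middle set has witnesses on both sides that survive.
\<close>

lemma trim_in_Y:
  assumes "group G" "group H" "group K" "subgroup N (G \<times>\<times> K)"
    and P: "P \<in> subgroup_pairs G H K" "N \<subseteq> fst P O snd P"
  shows "trim N P \<in> Y G H K N"
proof -
  obtain L M where [simp]: "P = (L, M)"
    by (cases P)
  have L: "subgroup L (G \<times>\<times> H)" and M: "subgroup M (H \<times>\<times> K)"
    using P by (auto simp: subgroup_pairs_def subgroups_def)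
  have N: "subgroup (fst ` N) G" "subgroup (snd ` N) K"
    using assms subgroup_projections by blast+
  let ?C = "middle N P"
  have C: "subgroup ?C H"
    unfolding middle_def using assms L M N
    by (auto intro!: group.subgroups_Inter_pair intro: subgroup_Image subgroup_converse)
  have through_C: "h \<in> ?C" if "(g, k) \<in> N" "(g, h) \<in> L" "(h, k) \<in> M" for g h k
    using that by (force simp: middle_def)
  have comp: "N \<subseteq> (L \<inter> fst ` N \<times> ?C) O (M \<inter> ?C \<times> snd ` N)"
  proof
    fix z assume z: "z \<in> N"
    obtain g k where [simp]: "z = (g, k)"
      by (cases z)
    from z P(2) obtain h where h: "(g, h) \<in> L" "(h, k) \<in> M"
      by auto
    moreover have "g \<in> fst ` N" "k \<in> snd ` N"
      using z by force+
    ultimately show "z \<in> (L \<inter> fst ` N \<times> ?C) O (M \<inter> ?C \<times> snd ` N)"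
      using through_C z by auto
  qed
  have "fst ` (L \<inter> fst ` N \<times> ?C) = fst ` N" "snd ` (M \<inter> ?C \<times> snd ` N) = snd ` N"
    using comp by force+
  moreover have "snd ` (L \<inter> fst ` N \<times> ?C) = ?C"
    by (force simp: middle_def)
  moreover have "fst ` (M \<inter> ?C \<times> snd ` N) = ?C"
    by (force simp: middle_def)
  moreover have "subgroup (L \<inter> fst ` N \<times> ?C) (G \<times>\<times> H)" "subgroup (M \<inter> ?C \<times> snd ` N) (H \<times>\<times> K)"
    using assms L M N C by (auto intro!: group.subgroups_Inter_pair DirProd_subgroups DirProd_group)
  ultimately show ?thesis
    using comp by (simp add: trim_def Y_def subgroup_pairs_def subgroups_def)
qed

text \<open>
  A pair in \<open>Y\<close> has the projections of \<open>N\<close> outside and a common projection inside, so all elements of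
  the latter lie on a path from \<open>p\<^sub>1(N)\<close> to \<open>p\<^sub>2(N)\<close>, and trimming a larger pair keeps them.
\<close>

lemma le_trim_iff:
  assumes "Q \<in> Y G H K N"
  shows "Q \<le> trim N P \<longleftrightarrow> Q \<le> P"
proof
  show "Q \<le> trim N P \<Longrightarrow> Q \<le> P"
    by (auto simp: trim_def less_eq_prod_def)
next
  obtain L' M' L M where [simp]: "Q = (L', M')" "P = (L, M)"
    by (cases P, cases Q)
  have Y: "fst ` L' = fst ` N" "snd ` L' = fst ` M'" "snd ` M' = snd ` N"
    using assms by (auto simp: Y_def)
  assume "Q \<le> P"
  then have le: "L' \<subseteq> L" "M' \<subseteq> M"
    by auto
  have "snd ` L' \<subseteq> L `` (fst ` N)"
    unfolding Y(1) [symmetric] using le by force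
  moreover have "snd ` L' \<subseteq> M\<inverse> `` (snd ` N)"
    unfolding Y(2) Y(3) [symmetric] using le by force
  ultimately have C: "snd ` L' \<subseteq> middle N P"
    by (simp add: middle_def)
  have "L' \<subseteq> fst ` N \<times> middle N P"
    unfolding Y(1) [symmetric] using C by force
  moreover have "M' \<subseteq> middle N P \<times> snd ` N"
    unfolding Y(3) [symmetric] using C [unfolded Y(2)] by force
  ultimately show "Q \<le> trim N P"
    using le by (simp add: trim_def)
qed

text \<open>
  The elements counted by \<open>\<kappa>\<close> lie on a path from \<open>\<one>\<close> to \<open>\<one>\<close>, and \<open>N\<close> contains the pair of units, so
  trimming removes none of them.
\<close>

lemma kappa_trim:
  assumes "subgroup N (G \<times>\<times> K)"
  shows "kappa G H K R (trim N P) = kappa G H K R P"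
proof -
  have one: "\<one>\<^bsub>G\<^esub> \<in> fst ` N" "\<one>\<^bsub>K\<^esub> \<in> snd ` N"
    using subgroup.one_closed [OF assms] by force+
  then have "k2 G H (fst (trim N P)) \<inter> k1 H K (snd (trim N P)) = k2 G H (fst P) \<inter> k1 H K (snd P)"
    unfolding trim_def k1_def k2_def middle_def by auto
  then show ?thesis
    by (simp add: kappa_def split_beta)
qed

section \<open>The coefficient as a sum over trimmed pairs\<close>

lemma finite_subgroup_pairs:
  assumes "finite (carrier G)" "finite (carrier H)" "finite (carrier K)"
  shows "finite (subgroup_pairs G H K)"
proof -
  have "subgroups (G \<times>\<times> H) \<subseteq> Pow (carrier G \<times> carrier H)"
    "subgroups (H \<times>\<times> K) \<subseteq> Pow (carrier H \<times> carrier K)"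
    by (auto simp: subgroups_def dest!: subgroup.subset)
  then show ?thesis
    unfolding subgroup_pairs_def using assms by (auto intro: finite_subset)
qed

theorem theorem4p2:
  fixes G :: "('a, 'm) monoid_scheme"
    and H :: "('b, 'n) monoid_scheme"
    and K :: "('c, 'o) monoid_scheme"
    and R :: "('r, 'p) ring_scheme"
  assumes "group G" "finite (carrier G)"
    and "group H" "finite (carrier H)"
    and "group K" "finite (carrier K)"
    and "cring R"
    and "[order H] \<cdot>\<^bsub>R\<^esub> \<one>\<^bsub>R\<^esub> \<in> Units R"
    and "subgroup L (G \<times>\<times> H)"
    and "subgroup M (H \<times>\<times> K)"
    and "subgroup N (G \<times>\<times> K)"
  shows "a_coeff G H K R N L M =
    (if (L, M) \<notin> Y G H K N then \<zero>\<^bsub>R\<^esub>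
     else (\<Oplus>\<^bsub>R\<^esub> P \<in> Y_below G H K N L M.
       [mobius (Y G H K N) P (L, M)] \<cdot>\<^bsub>R\<^esub> kappa G H K R P))"
proof -
  interpret R: cring R by fact
  let ?X = "subgroup_pairs G H K" and ?Y = "Y G H K N" and ?B = "Y_below G H K N L M"
  let ?y = "(L, M)" and ?k = "kappa G H K R"
  define U where "U = {P \<in> ?X. N \<subseteq> fst P O snd P}"
  define A where "A = {P \<in> U. P \<le> ?y}"
  have finX: "finite ?X"
    using assms by (simp add: finite_subgroup_pairs)
  have YU: "?Y \<subseteq> U" and UX: "U \<subseteq> ?X"
    by (auto simp: Y_def U_def)
  have fin: "finite A" "finite ?B"
    using finX YU UX by (auto simp: A_def Y_below_def intro: finite_subset)
  have y: "?y \<in> ?X"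
    using assms by (simp add: subgroup_pairs_def subgroups_def)
  have k: "?k P \<in> carrier R" for P
    using assms(8) by (auto simp: kappa_def split_beta)
  have up: "x \<in> U" if "u \<in> U" "x \<in> ?X" "u \<le> x" for u x
  proof -
    have "fst u O snd u \<subseteq> fst x O snd x"
      using that(3) by (intro relcomp_mono) (auto simp: less_eq_prod_def)
    with that(1,2) show ?thesis
      by (auto simp: U_def)
  qed
  have trim_Y: "trim N P \<in> ?Y" if "P \<in> U" for P
    using that assms trim_in_Y unfolding U_def by blast
  have fibre: "(\<Sum>P \<in> {P \<in> A. trim N P = w}. mobius ?X P ?y) =
      (if ?y \<in> ?Y then mobius ?Y w ?y else 0)" if "w \<in> ?Y" for w
  proof -
    have "{P \<in> A. trim N P = w} = {P \<in> U. P \<le> ?y \<and> trim N P = w}"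
      by (auto simp: A_def)
    then show ?thesis
      using finX UX YU up trim_Y le_trim_iff y that by (simp only:) (rule sum_mobius_fibre)
  qed
  have img: "trim N ` A \<subseteq> ?B"
  proof (rule image_subsetI)
    fix P assume "P \<in> A"
    then have P: "P \<in> U" "P \<le> ?y"
      by (simp_all add: A_def)
    have "trim N P \<le> P"
      using le_trim_iff [OF trim_Y [OF P(1)], of P] by simp
    then have "trim N P \<le> ?y"
      using P(2) by (rule order_trans)
    then show "trim N P \<in> ?B"
      using trim_Y [OF P(1)] by (simp add: Y_below_def)
  qed
  have "a_coeff G H K R N L M = (\<Oplus>\<^bsub>R\<^esub> P \<in> A. [mobius ?X P ?y] \<cdot>\<^bsub>R\<^esub> ?k P)"
    unfolding a_coeff_def A_def U_def by (rule arg_cong [where f = "finsum R _"]) auto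
  also have "\<dots> = (\<Oplus>\<^bsub>R\<^esub> P \<in> A. [mobius ?X P ?y] \<cdot>\<^bsub>R\<^esub> ?k (trim N P))"
    using assms by (simp add: kappa_trim)
  also have "\<dots> = (\<Oplus>\<^bsub>R\<^esub> w \<in> ?B. [(\<Sum>P \<in> {P \<in> A. trim N P = w}. mobius ?X P ?y)] \<cdot>\<^bsub>R\<^esub> ?k w)"
    using fin img k by (rule R.finsum_group_fibres)
  also have "\<dots> = (\<Oplus>\<^bsub>R\<^esub> w \<in> ?B. [(if ?y \<in> ?Y then mobius ?Y w ?y else 0)] \<cdot>\<^bsub>R\<^esub> ?k w)"
    using k by (intro R.finsum_cong' refl) (auto simp: Y_below_def fibre)
  also have "\<dots> = (if ?y \<notin> ?Y then \<zero>\<^bsub>R\<^esub> else (\<Oplus>\<^bsub>R\<^esub> w \<in> ?B. [mobius ?Y w ?y] \<cdot>\<^bsub>R\<^esub> ?k w))"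
    by (simp add: add_pow_def)
  finally show ?thesis .
qed

end
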